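(* For all integers $r\ge 0$ and $s\ge 2$, $$\zeta^{\star}(\underbrace{1,\ldots,1}_{r+1},\underbrace{2,\ldots,2}_{s-1}) = 2\sum_{m=0}^{\infty}\frac{1}{(m+1)^{2s-1}}\left(\sum_{i=0}^{r}S_m(\underbrace{1,\ldots,1}_{r-i})\,S^{\star}_m(\underbrace{1,\ldots,1}_{i})\right).$$
   Context: For integers $k_1,\ldots,k_n\ge 1$ with $k_n\ge 2$, the multiple zeta-star value is $$\zeta^{\star}(k_1,\ldots,k_n) := \sum_{0<m_1\le\cdots\le m_n}\frac{1}{m_1^{k_1}\cdots m_n^{k_n}}.$$ For integers $k_1,\ldots,k_n\ge 1$ and $m\ge 0$, define the finite multiple harmonic sums $$S_m(k_1,\ldots,k_n) := \sum_{0\le m_1<\cdots<m_n<m}\frac{1}{(m_1+1)^{k_1}\cdots(m_n+1)^{k_n}},$$ $$S^{\star}_m(k_1,\ldots,k_n) := \sum_{0\le m_1\le\cdots\le m_n\le m}\frac{1}{(m_1+1)^{k_1}\cdots(m_n+1)^{k_n}}.$$ For the empty index (length $0$), both $S_m$ and $S^{\star}_m$ are defined to be $1$. An underbrace with number $j$ means that the entry is repeated $j$ times. *)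

theory Defs
  imports "HOL-Analysis.Analysis"
begin

definition harmonic_term :: "nat list \<Rightarrow> nat list \<Rightarrow> real" where
  "harmonic_term ks ms = (\<Prod>j<length ks. 1 / real (ms ! j) ^ (ks ! j))"

definition zeta_star_indices :: "nat \<Rightarrow> nat list set" where
  "zeta_star_indices n = {ms. length ms = n \<and> sorted ms \<and> (\<forall>x\<in>set ms. 0 < x)}"

text \<open>
  As all terms are nonnegative, the value of the multiple series does not depend on the order of
  summation, so the unordered sum is used. As always, it is only meaningful together with
  summability.
\<close>

definition zeta_star :: "nat list \<Rightarrow> real" where
  "zeta_star ks = (\<Sum>\<^sub>\<infinity>ms\<in>zeta_star_indices (length ks). harmonic_term ks ms)"

definition S :: "nat \<Rightarrow> nat list \<Rightarrow> real" where
  "S m ks = (\<Sum>ms\<in>{ms. length ms = length ks \<and> sorted_wrt (<) ms \<and> (\<forall>x\<in>set ms. x < m)}.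
               harmonic_term ks (map Suc ms))"

definition S_star :: "nat \<Rightarrow> nat list \<Rightarrow> real" where
  "S_star m ks = (\<Sum>ms\<in>{ms. length ms = length ks \<and> sorted ms \<and> (\<forall>x\<in>set ms. x \<le> m)}.
                    harmonic_term ks (map Suc ms))"

text \<open>The index sets of the two finite sums are finite, so \<^const>\<open>sum\<close> has its intended value.\<close>

lemma finite_S_indices:
  "finite {ms. length ms = n \<and> sorted_wrt (<) ms \<and> (\<forall>x\<in>set ms. x < (m::nat))}"
  by (rule finite_subset[OF _ finite_lists_length_eq[of "{..<m}" n]]) auto

lemma finite_S_star_indices:
  "finite {ms. length ms = n \<and> sorted ms \<and> (\<forall>x\<in>set ms. x \<le> (m::nat))}"
  by (rule finite_subset[OF _ finite_lists_length_eq[of "{..m}" n]]) auto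

lemma S_Nil: "S m [] = 1"
proof -
  have "{ms. length ms = length ([] :: nat list) \<and> sorted_wrt (<) ms \<and> (\<forall>x\<in>set ms. x < m)} = {[]}"
    by auto
  then show ?thesis by (simp add: S_def harmonic_term_def)
qed

lemma S_star_Nil: "S_star m [] = 1"
proof -
  have "{ms. length ms = length ([] :: nat list) \<and> sorted ms \<and> (\<forall>x\<in>set ms. x \<le> m)} = {[]}"
    by auto
  then show ?thesis by (simp add: S_star_def harmonic_term_def)
qed

end

theory Submission
  imports Defs "HOL-Real_Asymp.Real_Asymp"
begin

text \<open>
  Let \<open>H\<^sub>k(x)\<close> be the product of the factors \<open>(1 + x/j) / (1 - x/j)\<close> for \<open>1 \<le> j \<le> k\<close>. Then
  \<open>H\<^sub>k - H\<^sub>k\<^sub>-\<^sub>1 = (2x/k) C\<^sub>k\<close>, where the coefficient of \<open>x\<^sup>r\<close> in \<open>C\<^sub>k\<close> is the inner sum of the theorem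
  at \<open>m = k - 1\<close>. With the weights \<open>w(n,k) = n!\<^sup>2 / ((n - k)! (n + k)!)\<close>, a telescoping argument gives
  \<open>1 / ((1 - x/1) \<dots> (1 - x/n)) = 1 + \<Sum>\<^sub>k w(n,k) (H\<^sub>k - H\<^sub>k\<^sub>-\<^sub>1)\<close>, whose coefficient of \<open>x\<^sup>r\<^sup>+\<^sup>1\<close> expands
  the truncated star sum of \<open>r + 1\<close> ones. Since \<open>w(n,k) - w(n-1,k) = (k/n)\<^sup>2 w(n,k)\<close>, each appended
  entry 2 divides the \<open>k\<close>-th term of the expansion by \<open>k\<^sup>2\<close>. Finally \<open>0 \<le> w \<le> 1\<close> and
  \<open>w(n,k) \<rightarrow> 1\<close> as \<open>n \<rightarrow> \<infinity>\<close>, so dominated convergence yields the theorem.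
\<close>

section \<open>Recurrences for finite harmonic sums\<close>

lemma harmonic_term_snoc:
  assumes "length ms = length ks"
  shows "harmonic_term (ks @ [k]) (ms @ [x]) = harmonic_term ks ms / real x ^ k"
proof -
  have "(\<Prod>j<length ks. 1 / real ((ms @ [x]) ! j) ^ ((ks @ [k]) ! j)) = harmonic_term ks ms"
    unfolding harmonic_term_def using assms by (intro prod.cong) (auto simp: nth_append)
  then show ?thesis
    using assms by (simp add: harmonic_term_def nth_append)
qed

lemma harmonic_term_nonneg: "harmonic_term ks ms \<ge> 0"
  by (auto simp: harmonic_term_def intro!: prod_nonneg)

lemma S_0_snoc: "S 0 (ks @ [k]) = 0"
proof -
  have "{ms. length ms = length (ks @ [k]) \<and> sorted_wrt (<) ms \<and> (\<forall>x\<in>set ms. x < (0::nat))} = {}"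
    by (auto simp: length_Suc_conv)
  then show ?thesis
    unfolding S_def by (simp only: sum.empty)
qed

text \<open>Split by whether the last entry equals the new maximal value \<open>m\<close>; if so,
  strictness keeps the earlier entries below \<open>m\<close>.\<close>

lemma S_Suc_snoc: "S (Suc m) (ks @ [k]) = S m (ks @ [k]) + S m ks / real (Suc m) ^ k"
proof -
  define I where "I = (\<lambda>n m. {ms. length ms = n \<and> sorted_wrt (<) ms \<and> (\<forall>x\<in>set ms. x < (m::nat))})"
  have fin: "finite (I n m)" for n m
    unfolding I_def by (rule finite_S_indices)
  have S: "S j ls = (\<Sum>ms\<in>I (length ls) j. harmonic_term ls (map Suc ms))" for j ls
    by (simp add: S_def I_def)
  let ?n = "length ks"
  let ?snoc = "\<lambda>ms. ms @ [m]"
  have "I (Suc ?n) (Suc m) = I (Suc ?n) m \<union> ?snoc ` I ?n m"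
  proof (intro equalityI subsetI)
    fix ms assume ms: "ms \<in> I (Suc ?n) (Suc m)"
    then obtain ns x where eq: "ms = ns @ [x]"
      unfolding I_def by (cases ms rule: rev_cases) auto
    show "ms \<in> I (Suc ?n) m \<union> ?snoc ` I ?n m"
    proof (cases "x = m")
      case True
      with ms have "ns \<in> I ?n m"
        by (auto simp: I_def eq sorted_wrt_append)
      then show ?thesis
        by (simp add: eq True)
    next
      case False
      with ms have "ms \<in> I (Suc ?n) m"
        by (auto simp: I_def eq sorted_wrt_append dest: less_trans)
      then show ?thesis ..
    qed
  qed (auto simp: I_def sorted_wrt_append intro: less_SucI)
  moreover have "I (Suc ?n) m \<inter> ?snoc ` I ?n m = {}"
    by (auto simp: I_def)
  moreover have "(\<Sum>ms\<in>?snoc ` I ?n m. harmonic_term (ks @ [k]) (map Suc ms)) =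
      (\<Sum>ms\<in>I ?n m. harmonic_term ks (map Suc ms) / real (Suc m) ^ k)"
    by (subst sum.reindex) (auto simp: inj_on_def I_def harmonic_term_snoc intro!: sum.cong)
  ultimately show ?thesis
    using fin by (simp add: S sum.union_disjoint sum_divide_distrib)
qed

lemma S_star_0: "S_star 0 ks = 1"
proof -
  have "{ms. length ms = length ks \<and> sorted ms \<and> (\<forall>x\<in>set ms. x \<le> (0::nat))} =
      {replicate (length ks) 0}"
    by (auto intro!: replicate_eqI)
  then show ?thesis
    by (simp add: S_star_def harmonic_term_def)
qed

text \<open>The same split, but after a last entry \<open>Suc m\<close> the earlier entries may
  still reach \<open>Suc m\<close>, so \<open>S_star (Suc m) ks\<close> appears instead of
  \<open>S_star m ks\<close>.\<close>

lemma S_star_Suc_snoc: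
  "S_star (Suc m) (ks @ [k]) = S_star m (ks @ [k]) + S_star (Suc m) ks / real (Suc (Suc m)) ^ k"
proof -
  define I where "I = (\<lambda>n m. {ms. length ms = n \<and> sorted ms \<and> (\<forall>x\<in>set ms. x \<le> (m::nat))})"
  have fin: "finite (I n m)" for n m
    unfolding I_def by (rule finite_S_star_indices)
  have S_star: "S_star j ls = (\<Sum>ms\<in>I (length ls) j. harmonic_term ls (map Suc ms))" for j ls
    by (simp add: S_star_def I_def)
  let ?n = "length ks"
  let ?snoc = "\<lambda>ms. ms @ [Suc m]"
  have "I (Suc ?n) (Suc m) = I (Suc ?n) m \<union> ?snoc ` I ?n (Suc m)"
  proof (intro equalityI subsetI)
    fix ms assume ms: "ms \<in> I (Suc ?n) (Suc m)"
    then obtain ns x where eq: "ms = ns @ [x]"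
      unfolding I_def by (cases ms rule: rev_cases) auto
    show "ms \<in> I (Suc ?n) m \<union> ?snoc ` I ?n (Suc m)"
    proof (cases "x = Suc m")
      case True
      with ms have "ns \<in> I ?n (Suc m)"
        by (simp add: I_def eq sorted_append)
      then show ?thesis
        by (simp add: eq True)
    next
      case False
      with ms have "ms \<in> I (Suc ?n) m"
        by (auto simp: I_def eq sorted_append dest: order.trans)
      then show ?thesis ..
    qed
  qed (auto simp: I_def sorted_append)
  moreover have "I (Suc ?n) m \<inter> ?snoc ` I ?n (Suc m) = {}"
    by (auto simp: I_def)
  moreover have "(\<Sum>ms\<in>?snoc ` I ?n (Suc m). harmonic_term (ks @ [k]) (map Suc ms)) =
      (\<Sum>ms\<in>I ?n (Suc m). harmonic_term ks (map Suc ms) / real (Suc (Suc m)) ^ k)"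
    by (subst sum.reindex) (auto simp: inj_on_def I_def harmonic_term_snoc intro!: sum.cong)
  ultimately show ?thesis
    using fin by (simp add: S_star sum.union_disjoint sum_divide_distrib)
qed

section \<open>From truncated star sums to the unordered series\<close>

text \<open>The truncations run over finite sets exhausting the index set. As all terms are
  nonnegative, the limit bounds every finite partial sum; this gives summability, and the unordered
  sum can then be read off along the truncations.\<close>

lemma zeta_star_has_sum:
  assumes "(\<lambda>N. S_star N ks) \<longlonglongrightarrow> L"
  shows "(harmonic_term ks has_sum L) (zeta_star_indices (length ks))"
proof -
  define Z where "Z = zeta_star_indices (length ks)"
  define I where "I = (\<lambda>N. {ms \<in> Z. \<forall>x\<in>set ms. x \<le> Suc N})"
  define J where "J = (\<lambda>N. {ms. length ms = length ks \<and> sorted ms \<and> (\<forall>x\<in>set ms. x \<le> (N::nat))})"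
  have I_eq: "I N = map Suc ` J N" for N
  proof (intro equalityI subsetI)
    fix ms assume ms: "ms \<in> I N"
    have "ms = map Suc (map (\<lambda>x. x - 1) ms)"
      using ms by (auto simp: I_def Z_def zeta_star_indices_def intro!: map_idI[symmetric])
    moreover have "map (\<lambda>x. x - 1) ms \<in> J N"
      using ms by (auto simp: I_def J_def Z_def zeta_star_indices_def sorted_iff_nth_mono
          intro!: diff_le_mono)
    ultimately show "ms \<in> map Suc ` J N"
      by blast
  qed (auto simp: I_def J_def Z_def zeta_star_indices_def sorted_iff_nth_mono)
  have fin: "finite (I N)" for N
    unfolding I_eq J_def by (intro finite_imageI finite_S_star_indices)
  have sum_I: "sum (harmonic_term ks) (I N) = S_star N ks" for N
    unfolding I_eq S_star_def J_def
    by (subst sum.reindex) (auto simp: inj_on_def)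
  have I_mono: "I M \<subseteq> I N" if "M \<le> N" for M N
    using that by (force simp: I_def)
  have exhaust: "\<exists>M. X \<subseteq> I M" if X: "finite X" "X \<subseteq> Z" for X
  proof
    \<comment> \<open>The largest entry occurring in \<open>X\<close> is a sufficient cutoff, since
      \<open>I M\<close> admits entries up to \<open>M + 1\<close>.\<close>
    show "X \<subseteq> I (Max (\<Union> (set ` X)))"
    proof
      fix ms assume ms: "ms \<in> X"
      have "x \<le> Max (\<Union> (set ` X))" if "x \<in> set ms" for x
        using X ms that by (intro Max_ge) auto
      then show "ms \<in> I (Max (\<Union> (set ` X)))"
        using X ms by (auto simp: I_def intro: le_SucI)
    qed
  qed
  have lim_I: "filterlim I (finite_subsets_at_top Z) sequentially"
    unfolding filterlim_finite_subsets_at_top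
  proof safe
    fix X assume "finite X" "X \<subseteq> Z"
    then obtain M where "X \<subseteq> I M"
      using exhaust by blast
    then show "\<forall>\<^sub>F N in sequentially. finite (I N) \<and> X \<subseteq> I N \<and> I N \<subseteq> Z"
    proof (intro eventually_sequentiallyI[of M] conjI)
      fix N assume "M \<le> N"
      with \<open>X \<subseteq> I M\<close> I_mono show "X \<subseteq> I N"
        by blast
      show "I N \<subseteq> Z"
        by (auto simp: I_def)
    qed (rule fin)
  qed
  have le_L: "S_star N ks \<le> L" for N
  proof (rule incseq_le[OF _ assms])
    show "incseq (\<lambda>N. S_star N ks)"
      unfolding sum_I[symmetric]
      by (intro incseq_SucI sum_mono2 fin I_mono harmonic_term_nonneg) auto
  qed
  have "harmonic_term ks summable_on Z"
  proof (rule nonneg_bdd_above_summable_on)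
    show "bdd_above (sum (harmonic_term ks) ` {F. F \<subseteq> Z \<and> finite F})"
    proof (rule bdd_aboveI2)
      fix X assume "X \<in> {F. F \<subseteq> Z \<and> finite F}"
      then obtain M where "X \<subseteq> I M"
        using exhaust by blast
      then have "sum (harmonic_term ks) X \<le> S_star M ks"
        unfolding sum_I[symmetric] by (intro sum_mono2 fin harmonic_term_nonneg)
      with le_L show "sum (harmonic_term ks) X \<le> L"
        by (rule order.trans[rotated])
    qed
  qed (rule harmonic_term_nonneg)
  then have hs: "(harmonic_term ks has_sum infsum (harmonic_term ks) Z) Z"
    by (rule has_sum_infsum)
  have "(\<lambda>N. S_star N ks) \<longlonglongrightarrow> infsum (harmonic_term ks) Z"
    using filterlim_compose[OF hs[unfolded has_sum_def] lim_I] by (simp add: sum_I)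
  with hs show ?thesis
    using LIMSEQ_unique[OF assms] by (simp add: Z_def)
qed

section \<open>Generating functions\<close>

unbundle no vec_syntax and fps_syntax

text \<open>Generating function of the elementary symmetric polynomials in 1, 1/2, ..., 1/m.\<close>

definition elem_fps :: "nat \<Rightarrow> real fps" where
  "elem_fps m = (\<Prod>j<m. 1 + fps_const (1 / real (Suc j)) * fps_X)"

text \<open>Generating function of the complete homogeneous symmetric polynomials in the same
  numbers.\<close>

definition compl_fps :: "nat \<Rightarrow> real fps" where
  "compl_fps m = (\<Prod>j<m. inverse (1 - fps_const (1 / real (Suc j)) * fps_X))"

text \<open>The product H_m of the overview.\<close>

definition quot_fps :: "nat \<Rightarrow> real fps" where
  "quot_fps m = elem_fps m * compl_fps m"

lemma elem_fps_Suc: "elem_fps (Suc m) = elem_fps m * (1 + fps_const (1 / real (Suc m)) * fps_X)"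
  by (simp add: elem_fps_def)

lemma compl_fps_Suc:
  "compl_fps (Suc m) * (1 - fps_const (1 / real (Suc m)) * fps_X) = compl_fps m"
proof -
  have "inverse (1 - fps_const (1 / real (Suc m)) * fps_X) *
      (1 - fps_const (1 / real (Suc m)) * fps_X) = 1"
    by (rule inverse_mult_eq_1) (simp add: fps_nth_fps_const)
  then show ?thesis
    by (simp add: compl_fps_def mult.assoc)
qed

lemma fps_mult_const_X_nth: "(f * (fps_const c * fps_X)) $ Suc r = c * f $ r"
  for f :: "real fps"
  by (simp add: mult.left_commute[of f])

lemma compl_fps_nth_Suc:
  "compl_fps (Suc m) $ Suc r = compl_fps m $ Suc r + compl_fps (Suc m) $ r / real (Suc m)"
  using arg_cong[OF compl_fps_Suc[of m], of "\<lambda>f. f $ Suc r"]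
  by (simp add: right_diff_distrib fps_mult_const_X_nth diff_eq_eq del: of_nat_Suc)

lemma elem_fps_nth_Suc:
  "elem_fps (Suc m) $ Suc r = elem_fps m $ Suc r + elem_fps m $ r / real (Suc m)"
  by (simp add: elem_fps_Suc distrib_left fps_mult_const_X_nth del: of_nat_Suc)

lemma fps_nth_0_elem_compl: "elem_fps m $ 0 = 1" "compl_fps m $ 0 = 1"
  by (induction m) (auto simp: elem_fps_def compl_fps_def)

lemma elem_fps_nth: "elem_fps m $ r = S m (replicate r 1)"
proof (induction m arbitrary: r)
  case 0
  then show ?case
    by (cases r) (auto simp: S_Nil elem_fps_def S_0_snoc simp flip: replicate_append_same)
next
  case (Suc m)
  then show ?case
  proof (cases r)
    case (Suc q)
    then show ?thesis
      using Suc.IH[of r] Suc.IH[of q] S_Suc_snoc[of m "replicate q 1" 1]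
      by (simp add: elem_fps_nth_Suc replicate_append_same)
  qed (simp add: S_Nil fps_nth_0_elem_compl)
qed

text \<open>The index is \<open>Suc m\<close> because \<open>S_star m\<close> admits denominators up
  to m + 1. The recurrence refers to \<open>Suc m\<close> again at lower degree, hence the inner
  induction on \<open>r\<close>.\<close>

lemma compl_fps_nth: "compl_fps (Suc m) $ r = S_star m (replicate r 1)"
proof (induction m arbitrary: r)
  case 0
  show ?case
    unfolding S_star_0
    by (induction r) (auto simp: fps_nth_0_elem_compl compl_fps_nth_Suc, simp add: compl_fps_def)
next
  case (Suc m)
  note outer = this
  show ?case
  proof (induction r)
    case 0
    then show ?case
      by (simp add: S_star_Nil fps_nth_0_elem_compl)
  next
    case (Suc r)
    then show ?case
      using outer[of "Suc r"] S_star_Suc_snoc[of m "replicate r 1" 1] compl_fps_nth_Suc[of "Suc m" r]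
      by (simp add: replicate_append_same)
  qed
qed

text \<open>Both quotients are multiples of \<open>elem_fps m * compl_fps (Suc m)\<close>, with
  factors 1 + x/(m+1) and 1 - x/(m+1).\<close>

lemma quot_fps_diff:
  "quot_fps (Suc m) - quot_fps m =
     fps_const (2 / real (Suc m)) * fps_X * (elem_fps m * compl_fps (Suc m))"
proof -
  have "fps_const (2 / real (Suc m)) = fps_const (1 / real (Suc m)) + fps_const (1 / real (Suc m))"
    by simp
  then show ?thesis
    unfolding quot_fps_def compl_fps_Suc[of m, symmetric] elem_fps_Suc
    by (simp only: algebra_simps)
qed

lemma quot_fps_add: "quot_fps (Suc m) + quot_fps m = 2 * (elem_fps m * compl_fps (Suc m))"
  unfolding quot_fps_def compl_fps_Suc[of m, symmetric] elem_fps_Suc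
  by (simp add: algebra_simps)

lemma quot_fps_diff_nth:
  "quot_fps (Suc m) $ Suc r - quot_fps m $ Suc r =
     2 * (elem_fps m * compl_fps (Suc m)) $ r / real (Suc m)"
  using arg_cong[OF quot_fps_diff[of m], of "\<lambda>f. f $ Suc r"]
  by (simp add: mult.assoc del: of_nat_Suc)

lemma quot_fps_add_nth:
  "quot_fps (Suc m) $ r + quot_fps m $ r = 2 * (elem_fps m * compl_fps (Suc m)) $ r"
  using arg_cong[OF quot_fps_add[of m], of "\<lambda>f. f $ r"]
  by (simp add: numeral_fps_const)

text \<open>Eliminating the common factor from sum and difference relates degree r + 1 to degree r;
  this drives both the growth bound and the telescoping.\<close>

lemma quot_fps_diff_nth':
  "real (Suc m) * (quot_fps (Suc m) $ Suc r - quot_fps m $ Suc r) =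
     quot_fps (Suc m) $ r + quot_fps m $ r"
  unfolding quot_fps_diff_nth quot_fps_add_nth by simp

lemma quot_fps_0: "quot_fps 0 = 1"
  by (simp add: quot_fps_def elem_fps_def compl_fps_def)

lemma quot_fps_nth_0: "quot_fps m $ 0 = 1"
  by (simp add: quot_fps_def fps_nth_0_elem_compl)

text \<open>A crude bound, linear in \<open>m\<close>, that still yields convergence after division
  by (m+1)^3. Increments in degree r + 1 are at most 3^(r+1).\<close>

lemma quot_fps_nth_bounds: "0 \<le> quot_fps m $ r \<and> quot_fps m $ r \<le> 3 ^ r * real (Suc m)"
proof (induction r arbitrary: m)
  case 0
  then show ?case
    by (simp add: quot_fps_nth_0)
next
  case (Suc r)
  note outer = this
  show ?case
  proof (induction m)
    case 0
    then show ?case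
      by (simp add: quot_fps_0)
  next
    case (Suc m)
    define d where "d = quot_fps (Suc m) $ Suc r - quot_fps m $ Suc r"
    have d: "real (Suc m) * d = quot_fps (Suc m) $ r + quot_fps m $ r"
      unfolding d_def by (rule quot_fps_diff_nth')
    have "real (Suc m) * d \<ge> 0"
      using outer[of m] outer[of "Suc m"] d by simp
    then have "d \<ge> 0"
      by (simp add: zero_le_mult_iff)
    have "real (Suc m) * d \<le> 3 ^ r * real (Suc (Suc m)) + 3 ^ r * real (Suc m)"
      using outer[of m] outer[of "Suc m"] d by linarith
    also have "\<dots> = 3 ^ r * (2 * real m + 3)"
      by (simp add: algebra_simps)
    also have "\<dots> \<le> 3 ^ r * (3 * real m + 3)"
      by (intro mult_left_mono) auto
    also have "\<dots> = real (Suc m) * 3 ^ Suc r"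
      by (simp add: algebra_simps)
    finally have "d \<le> 3 ^ Suc r"
      by (simp only: mult_le_cancel_left_pos of_nat_0_less_iff zero_less_Suc)
    with \<open>d \<ge> 0\<close> Suc show ?case
      by (auto simp: d_def algebra_simps)
  qed
qed

section \<open>The weights\<close>

text \<open>For \<open>k \<le> n\<close> this is \<open>n!\<^sup>2 / ((n - k)! (n + k)!)\<close>; for \<open>k > n\<close> it vanishes.\<close>

definition weight :: "nat \<Rightarrow> nat \<Rightarrow> real" where
  "weight n k = (\<Prod>j<k. (real n - real j) / (real n + real j + 1))"

lemma weight_0: "weight n 0 = 1"
  by (simp add: weight_def)

lemma weight_Suc: "weight n (Suc k) = weight n k * ((real n - real k) / (real n + real k + 1))"
  by (simp add: weight_def)

lemma weight_Suc': "weight n (Suc k) * (real n + real k + 1) = weight n k * (real n - real k)"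
proof -
  have "real n + real k + 1 \<noteq> 0"
    by linarith
  then show ?thesis
    by (simp add: weight_Suc)
qed

lemma weight_eq_0: "k > n \<Longrightarrow> weight n k = 0"
  unfolding weight_def by (rule prod_zero) auto

lemma weight_bounds: "0 \<le> weight n k \<and> weight n k \<le> 1"
proof (induction k)
  case (Suc k)
  show ?case
  proof (cases "k \<le> n")
    case True
    then have "0 \<le> (real n - real k) / (real n + real k + 1)"
      "(real n - real k) / (real n + real k + 1) \<le> 1"
      by auto
    with Suc show ?thesis
      unfolding weight_Suc by (intro conjI mult_nonneg_nonneg mult_le_one) auto
  qed (simp add: weight_eq_0)
qed (simp add: weight_0)

text \<open>The rule for w(n,k) - w(n-1,k) from the overview, shifted and cleared of
  denominators.\<close>

lemma weight_Suc_left: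
  "weight (Suc n) k * ((real n + 1)\<^sup>2 - (real k)\<^sup>2) = weight n k * (real n + 1)\<^sup>2"
proof (induction k)
  case (Suc k)
  have nz: "real n + real k + 1 \<noteq> 0"
    by linarith
  \<comment> \<open>Uses (n+1)^2 - (k+1)^2 = (n-k)(n+k+2); the extra factor n+k+1 is the denominator
    in \<open>weight n (Suc k)\<close>.\<close>
  have "weight (Suc n) (Suc k) * ((real n + 1)\<^sup>2 - (real (Suc k))\<^sup>2) * (real n + real k + 1)
      = (weight (Suc n) (Suc k) * (real (Suc n) + real k + 1)) * (real n - real k)
          * (real n + real k + 1)"
    by (simp add: algebra_simps power2_eq_square)
  also have "\<dots> = (weight (Suc n) k * ((real n + 1)\<^sup>2 - (real k)\<^sup>2)) * (real n - real k)"
    unfolding weight_Suc' by (simp add: algebra_simps power2_eq_square)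
  also have "\<dots> = (weight n (Suc k) * (real n + real k + 1)) * (real n + 1)\<^sup>2"
    unfolding weight_Suc' Suc.IH by (simp add: algebra_simps)
  finally show ?case
    using nz by (simp only: mult.commute mult.left_commute mult_cancel_left) auto
qed (simp add: weight_0)

lemma weight_tendsto: "(\<lambda>n. weight n k) \<longlonglongrightarrow> 1"
proof (induction k)
  case (Suc k)
  have "(\<lambda>n. (real n - real k) / (real n + real k + 1)) \<longlonglongrightarrow> 1"
    by real_asymp
  from tendsto_mult[OF Suc this] show ?case
    by (simp add: weight_Suc)
qed (simp add: weight_0)

section \<open>Expansion of the truncated sums\<close>

text \<open>Up to a telescoping sum, the right-hand side satisfies the recurrence
  \<open>compl_fps_nth_Suc\<close>.\<close>

lemma compl_fps_expansion:
  "compl_fps n $ r =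
     (if r = 0 then 1 else 0) + (\<Sum>k<n. weight n (Suc k) * (quot_fps (Suc k) $ r - quot_fps k $ r))"
proof (induction r arbitrary: n)
  case 0
  then show ?case
    by (simp add: quot_fps_nth_0 fps_nth_0_elem_compl)
next
  case (Suc r)
  note outer = this
  define D where "D = (\<lambda>k r. quot_fps (Suc k) $ r - quot_fps k $ r)"
  show ?case
  proof (induction n)
    case 0
    then show ?case
      by (simp add: compl_fps_def)
  next
    case (Suc n)
    define N where "N = real (Suc n)"
    have "N > 0"
      by (simp add: N_def)
    define w where "w = weight (Suc n)"
    \<comment> \<open>The telescoping potential: by \<open>weight_Suc'\<close>, \<open>u k\<close>
      is also w(k+1) (N+k+1) times the coefficient of H_k, so \<open>u k - u (Suc k)\<close>
      combines the sum and the difference of consecutive coefficients.\<close>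
    define u where "u = (\<lambda>k. w k * (N - real k) * quot_fps k $ r)"
    have w: "weight n k = w k * (1 - (real k)\<^sup>2 / N\<^sup>2)" for k
    proof -
      have "weight n k * N\<^sup>2 = w k * (N\<^sup>2 - (real k)\<^sup>2)"
        using weight_Suc_left[of n k] by (simp add: N_def w_def add.commute)
      with \<open>N > 0\<close> show ?thesis
        by (simp add: field_simps)
    qed
    have step: "w (Suc k) * D k (Suc r) - weight n (Suc k) * D k (Suc r) - w (Suc k) * D k r / N
        = (u k - u (Suc k)) / N\<^sup>2" for k
    proof -
      have D: "real (Suc k) * D k (Suc r) = quot_fps (Suc k) $ r + quot_fps k $ r"
        unfolding D_def by (rule quot_fps_diff_nth')
      have u: "u k = w (Suc k) * (N + real k + 1) * quot_fps k $ r"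
        unfolding u_def w_def N_def weight_Suc' by simp
      have "w (Suc k) * D k (Suc r) - weight n (Suc k) * D k (Suc r) - w (Suc k) * D k r / N
          = w (Suc k) * (real (Suc k) * (real (Suc k) * D k (Suc r)) - N * D k r) / N\<^sup>2"
        using \<open>N > 0\<close> unfolding w by (simp add: field_simps power2_eq_square del: of_nat_Suc)
      also have "w (Suc k) * (real (Suc k) * (real (Suc k) * D k (Suc r)) - N * D k r) = u k - u (Suc k)"
        unfolding D u by (simp add: u_def D_def algebra_simps)
      finally show ?thesis .
    qed
    have "(\<Sum>k<Suc n. w (Suc k) * D k (Suc r)) - (\<Sum>k<Suc n. weight n (Suc k) * D k (Suc r))
        - (\<Sum>k<Suc n. w (Suc k) * D k r) / N = (\<Sum>k<Suc n. (u k - u (Suc k)) / N\<^sup>2)"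
      unfolding step[symmetric] by (simp only: sum_subtractf sum_divide_distrib)
    also have "\<dots> = (u 0 - u (Suc n)) / N\<^sup>2"
      unfolding sum_divide_distrib[symmetric] sum_lessThan_telescope' ..
    \<comment> \<open>The factor \<open>N - real k\<close> vanishes at k = n + 1. The other boundary
      term, \<open>u 0\<close>, supplies the constant of the expansion in degree
      \<open>r\<close>.\<close>
    also have "u (Suc n) = 0"
      by (simp add: u_def N_def)
    also have "u 0 = N * (if r = 0 then 1 else 0)"
      by (simp add: u_def w_def weight_0 quot_fps_0)
    finally have "(\<Sum>k<Suc n. w (Suc k) * D k (Suc r)) = (\<Sum>k<Suc n. weight n (Suc k) * D k (Suc r))
        + ((if r = 0 then 1 else 0) + (\<Sum>k<Suc n. w (Suc k) * D k r)) / N"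
      using \<open>N > 0\<close> by (simp add: field_simps power2_eq_square split: if_splits)
    \<comment> \<open>The extra term k = n is zero because
      \<open>weight n (Suc n) = 0\<close>.\<close>
    also have "(\<Sum>k<Suc n. weight n (Suc k) * D k (Suc r)) = compl_fps n $ Suc r"
      using Suc.IH by (simp add: D_def weight_eq_0)
    also have "(if r = 0 then 1 else 0) + (\<Sum>k<Suc n. w (Suc k) * D k r) = compl_fps (Suc n) $ r"
      using outer[of "Suc n"] unfolding w_def D_def by simp
    finally show ?case
      unfolding compl_fps_nth_Suc w_def D_def N_def by simp
  qed
qed

text \<open>Induction on the number of twos, starting from \<open>compl_fps_expansion\<close> in
  degree r + 1. In the step both sides obey the same recurrence in \<open>n\<close>, since raising
  \<open>n\<close> changes the weight by (k+1)^2/(n+1)^2 times itself, for the raised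
  \<open>n\<close> in \<open>weight n (Suc k)\<close>.\<close>

lemma S_star_expansion:
  "S_star n (replicate (Suc r) 1 @ replicate t 2) =
     (\<Sum>k\<le>n. weight (Suc n) (Suc k) *
        (2 * (elem_fps k * compl_fps (Suc k)) $ r / real (Suc k) ^ (2 * t + 1)))"
proof (induction t arbitrary: n)
  case 0
  then show ?case
    using compl_fps_expansion[of "Suc n" "Suc r"]
    unfolding compl_fps_nth quot_fps_diff_nth lessThan_Suc_atMost by simp
next
  case (Suc t)
  note outer = this
  define c where "c = (\<lambda>t k. 2 * (elem_fps k * compl_fps (Suc k)) $ r / real (Suc k) ^ (2 * t + 1))"
  let ?ks = "replicate (Suc r) 1 @ replicate t (2::nat)"
  have app: "replicate (Suc r) 1 @ replicate (Suc t) 2 = ?ks @ [2]"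
    by (simp flip: replicate_append_same)
  have diff: "weight (Suc n) (Suc k) * c (Suc t) k =
      weight n (Suc k) * c (Suc t) k + weight (Suc n) (Suc k) * c t k / real (Suc n) ^ 2" for n k
  proof -
    have "weight n (Suc k) * real (Suc n) ^ 2 =
        weight (Suc n) (Suc k) * (real (Suc n) ^ 2 - real (Suc k) ^ 2)"
      using weight_Suc_left[of n "Suc k"] by (simp add: add.commute)
    then have w: "weight n (Suc k) =
        weight (Suc n) (Suc k) * (real (Suc n) ^ 2 - real (Suc k) ^ 2) / real (Suc n) ^ 2"
      by (simp add: eq_divide_eq del: of_nat_Suc)
    have c: "c t k = c (Suc t) k * real (Suc k) ^ 2"
      by (simp add: c_def power2_eq_square del: of_nat_Suc)
    show ?thesis
      unfolding w c by (simp add: field_simps del: of_nat_Suc)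
  qed
  have "S_star n (?ks @ [2]) = (\<Sum>k\<le>n. weight (Suc n) (Suc k) * c (Suc t) k)"
  proof (induction n)
    case 0
    \<comment> \<open>At k = 0 the denominators are powers of 1, so \<open>c t 0\<close> is
      independent of \<open>t\<close>.\<close>
    have "weight (Suc 0) (Suc 0) * c t 0 = 1"
      using outer[of 0] by (simp add: S_star_0 c_def)
    then show ?case
      by (simp add: S_star_0 c_def)
  next
    case (Suc n)
    have "(\<Sum>k\<le>Suc n. weight (Suc (Suc n)) (Suc k) * c (Suc t) k) =
        (\<Sum>k\<le>Suc n. weight (Suc n) (Suc k) * c (Suc t) k) +
        (\<Sum>k\<le>Suc n. weight (Suc (Suc n)) (Suc k) * c t k) / real (Suc (Suc n)) ^ 2"
      unfolding diff[of "Suc n"] sum.distrib sum_divide_distrib ..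
    also have "(\<Sum>k\<le>Suc n. weight (Suc n) (Suc k) * c (Suc t) k) = S_star n (?ks @ [2])"
      using Suc.IH by (simp add: weight_eq_0)
    also have "(\<Sum>k\<le>Suc n. weight (Suc (Suc n)) (Suc k) * c t k) = S_star (Suc n) ?ks"
      using outer[of "Suc n"] by (simp only: c_def)
    finally show ?case
      by (simp only: S_star_Suc_snoc)
  qed
  then show ?case
    by (simp only: app c_def)
qed

section \<open>Passage to the limit\<close>

theorem mainTheorem1:
  fixes r s :: nat
  assumes "s \<ge> 2"
  defines "ks \<equiv> replicate (r + 1) 1 @ replicate (s - 1) 2"
  defines "a \<equiv> (\<lambda>m. 1 / real (m + 1) ^ (2 * s - 1) *
                  (\<Sum>i=0..r. S m (replicate (r - i) 1) * S_star m (replicate i 1)))"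
  shows "harmonic_term ks summable_on zeta_star_indices (length ks) \<and> summable a \<and>
         zeta_star ks = 2 * (\<Sum>m. a m)"
proof -
  define C where "C = (\<lambda>k. (elem_fps k * compl_fps (Suc k)) $ r)"
  have C: "C m = (\<Sum>i=0..r. S m (replicate (r - i) 1) * S_star m (replicate i 1))" for m
    unfolding C_def
    by (subst mult.commute) (simp add: fps_mult_nth compl_fps_nth elem_fps_nth mult.commute[of "S_star _ _"])
  \<comment> \<open>This makes the exponent 2s - 1 at least 3, enough to absorb the linear growth of
    \<open>C\<close>.\<close>
  obtain t where s: "s = Suc (Suc t)"
    using assms(1) by (metis Suc_le_D numeral_2_eq_2 Suc_le_mono)
  have a: "a m = C m / real (Suc m) ^ (2 * Suc t + 1)" for m
    by (simp add: a_def C s)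
  \<comment> \<open>\<open>C m\<close> is the mean of two consecutive coefficients of
    \<open>quot_fps\<close>.\<close>
  have C_bounds: "0 \<le> C m" "C m \<le> 3 ^ r * real (m + 2)" for m
  proof -
    have "3 ^ r * real (Suc (Suc m)) + 3 ^ r * real (Suc m) = 3 ^ r * (2 * real m + 3)"
      by (simp add: algebra_simps)
    also have "\<dots> \<le> 3 ^ r * (2 * real (m + 2))"
      by (intro mult_left_mono) auto
    finally show "0 \<le> C m" "C m \<le> 3 ^ r * real (m + 2)"
      using quot_fps_add_nth[of m r] quot_fps_nth_bounds[of m r] quot_fps_nth_bounds[of "Suc m" r]
      unfolding C_def by linarith+
  qed
  have a_nonneg: "0 \<le> a m" for m
    using C_bounds(1) by (simp add: a)
  have a_le: "a m \<le> 2 * 3 ^ r * (1 / real (Suc m) ^ 2)" for m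
  proof -
    have "a m \<le> C m / real (Suc m) ^ 3"
      unfolding a using C_bounds(1) by (intro divide_left_mono power_increasing) auto
    also have "\<dots> \<le> (3 ^ r * (2 * real (Suc m))) / real (Suc m) ^ 3"
      by (intro divide_right_mono order.trans[OF C_bounds(2)] mult_left_mono) auto
    also have "\<dots> = 2 * 3 ^ r * (1 / real (Suc m) ^ 2)"
      by (simp add: power2_eq_square power3_eq_cube del: of_nat_Suc)
    finally show ?thesis .
  qed
  have sum_a: "summable a"
  proof (rule summable_comparison_test)
    show "\<exists>N. \<forall>n\<ge>N. norm (a n) \<le> 2 * 3 ^ r * (1 / real (Suc n) ^ 2)"
      using a_nonneg a_le by simp
    have "summable (\<lambda>n. 1 / real n ^ 2)"
      using inverse_power_summable[of 2] by (simp add: inverse_eq_divide)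
    from summable_Suc_iff[THEN iffD2, OF this]
    show "summable (\<lambda>n. 2 * 3 ^ r * (1 / real (Suc n) ^ 2))"
      by (rule summable_mult)
  qed
  \<comment> \<open>Vanishing weights turn the finite sum into a series over a fixed range, as
    Tannery's theorem requires; \<open>2 * a k\<close> is the majorant.\<close>
  have trunc: "S_star n ks = (\<Sum>k. weight (Suc n) (Suc k) * (2 * a k))" for n
  proof -
    have "S_star n ks = (\<Sum>k\<le>n. weight (Suc n) (Suc k) * (2 * a k))"
      using S_star_expansion[of n r "Suc t"] by (simp add: ks_def s a C_def del: of_nat_Suc)
    then show ?thesis
      by (subst suminf_finite[of "{..n}"]) (auto simp: weight_eq_0)
  qed
  have "(\<lambda>n. \<Sum>k. weight (Suc n) (Suc k) * (2 * a k)) \<longlonglongrightarrow> (\<Sum>k. 2 * a k)"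
  proof -
    have bound: "\<forall>\<^sub>F (k, n) in at_top \<times>\<^sub>F sequentially.
        norm (weight (Suc n) (Suc k) * (2 * a k)) \<le> 2 * a k"
    proof (rule always_eventually, clarify)
      fix k n
      show "norm (weight (Suc n) (Suc k) * (2 * a k)) \<le> 2 * a k"
        using weight_bounds[of "Suc n" "Suc k"] a_nonneg[of k]
        by (simp add: abs_mult mult_left_le_one_le)
    qed
    have "(\<lambda>n. weight (Suc n) (Suc k) * (2 * a k)) \<longlonglongrightarrow> 2 * a k" for k
      using tendsto_mult_right[OF LIMSEQ_Suc[OF weight_tendsto[of "Suc k"]], of "2 * a k"] by simp
    from tannerys_theorem[OF this bound summable_mult[OF sum_a]] show ?thesis
      by simp
  qed
  then have "(\<lambda>n. S_star n ks) \<longlonglongrightarrow> 2 * (\<Sum>m. a m)"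
    by (simp only: trunc suminf_mult[OF sum_a])
  then have "(harmonic_term ks has_sum (2 * (\<Sum>m. a m))) (zeta_star_indices (length ks))"
    by (rule zeta_star_has_sum)
  with sum_a show ?thesis
    by (auto simp: zeta_star_def summable_on_def dest: infsumI)
qed

end
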